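(* Let $\mathcal{X}\in\mathfrak{Ghol}$ and let $M\in\mathrm{Aut}\,\mathcal{X}$ be an element of Type I which is neither $\pm\iota$ nor $\pm I$. Then the cusp shapes of $\mathcal{X}$ are contained either in $\mathbb{Q}(\sqrt{-3})$ or in $\mathbb{Q}(\sqrt{-1})$. More specifically, the following statements hold. (1) Suppose the cusp shapes of $\mathcal{X}$ are contained in $\mathbb{Q}(\sqrt{-3})$. (a) If $\mathfrak{m}_M(x)=x^2+x+1$ (resp. $x^2-x+1$), then $M$ is one of $A_1\oplus A_4$, $A_1\oplus(-I)$ or $(-I)\oplus A_4$ (resp. $A_1\oplus A_4$, $A_1\oplus I$ or $I\oplus A_4$) for some $A_i\in\mathrm{GL}_2(\mathbb{Q})$ ($i=1,4$) satisfying $\mathfrak{m}_{A_i}(x)=x^2+x+1$ (resp. $x^2-x+1$). (b) If $\mathfrak{m}_M(x)=x^3-1$ (resp. $x^3+1$), then $M$ is either $A_1\oplus I$ or $I\oplus A_4$ (resp. $A_1\oplus(-I)$ or $(-I)\oplus A_4$) for some $A_i\in\mathrm{GL}_2(\mathbb{Q})$ ($i=1,4$) satisfying $\mathfrak{m}_{A_i}(x)=x^2+x+1$ (resp. $x^2-x+1$). (c) If $\mathfrak{m}_M(x)=x^3-2x^2+2x-1$ (resp. $x^3+2x^2+2x+1$), then $M$ is either $A_1\oplus I$ or $I\oplus A_4$ (resp. $A_1\oplus(-I)$ or $(-I)\oplus A_4$) for some $A_i\in\mathrm{GL}_2(\mathbb{Q})$ ($i=1,4$) satisfying $\mathfrak{m}_{A_i}(x)=x^2-x+1$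 (resp. $x^2+x+1$). (d) If $\mathfrak{m}_M(x)=x^4+x^2+1$, then $M$ is either $A_1\oplus(-A_4)$ or $(-A_1)\oplus A_4$ for some $A_i\in\mathrm{GL}_2(\mathbb{Q})$ ($i=1,4$) satisfying $\mathfrak{m}_{A_i}(x)=x^2+x+1$. (2) Suppose the cusp shapes of $\mathcal{X}$ are contained in $\mathbb{Q}(\sqrt{-1})$. (a) If $\mathfrak{m}_M(x)=x^2+1$, then $M$ is of the form $A_1\oplus A_4$ for some $A_i\in\mathrm{GL}_2(\mathbb{Q})$ ($i=1,4$) satisfying $\mathfrak{m}_{A_i}(x)=x^2+1$. (b) If $\mathfrak{m}_M(x)=x^3-x^2+x-1$ (resp. $x^3+x^2+x+1$), then $M$ is either $A_1\oplus I$ or $I\oplus A_4$ (resp. $A_1\oplus(-I)$ or $(-I)\oplus A_4$) for some $A_i\in\mathrm{GL}_2(\mathbb{Q})$ ($i=1,4$) satisfying $\mathfrak{m}_{A_i}(x)=x^2+1$.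
   Context: Generalized analytic holonomy sets: $\mathfrak{Ghol}$ is the set of analytic sets (germs at $0$) $\mathcal{X}\subset\mathbb{C}^4$, coordinates $(u_1,v_1,u_2,v_2)$, defined by holomorphic functions $v_i(u_1,u_2)=\tau_iu_i+(\text{terms of odd total degree}\ge3)$, $i=1,2$, such that: $\tau_i\in\mathbb{C}\setminus\mathbb{R}$ with $\mathrm{Im}\,\tau_i>0$; $v_1(u_1,0)\ne\tau_1u_1$ and $v_2(0,u_2)\neq\tau_2u_2$ as functions; $v_1$ is odd in $u_1$ and even in $u_2$, $v_2$ is even in $u_1$ and odd in $u_2$; $\frac{\partial v_1}{\partial u_2}=a\frac{\partial v_2}{\partial u_1}$ for some $a\in\mathbb{C}$; every subgroup of $\mathrm{Aut}\,\mathcal{X}$ contained in $\mathrm{GL}_4(\mathbb{Q})$ is finite. The numbers $\tau_1,\tau_2$ are called the cusp shapes of $\mathcal{X}$; standing assumption: they belong to the same quadratic field. A matrix $M\in\mathrm{GL}_4(\mathbb{Q})$ belongs to $\mathrm{Aut}\,\mathcal{X}$ if $\mathbf{x}\mapsto M\mathbf{x}$, $\mathbf{x}=(u_1,v_1,u_2,v_2)^T$, maps (the germ at $0$ of) $\mathcal{X}$ to itself. Write $M\in\mathrm{GL}_4(\mathbb{Q})$ in $2\times2$ blocks as $\begin{pmatrix} A_1 & A_2 \\ A_3 & A_4 \end{pmatrix}$. $M$ is of Type I if $A_2=A_3=0$ and $\det A_1=\det A_4=1$. $A\oplus B:=\begin{pmatrix} A & 0 \\ 0 & B \end{pmatrix}$;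 $\iota:=I\oplus(-I)$ with $I$ the $2\times2$ identity. $\mathfrak{m}_A(x)$ is the minimal polynomial of $A$ over $\mathbb{Q}$. *)

theory Defs
  imports
    "HOL-Analysis.Analysis"
    "HOL-Algebra.Group"
    "HOL-Computational_Algebra.Polynomial"
    "HOL-Computational_Algebra.Squarefree"
begin

definition Qsqrt :: "int \<Rightarrow> complex set" where
  "Qsqrt d = {of_rat a + of_rat b * csqrt (of_int d) | a b. True}"

definition quadratic_field :: "complex set \<Rightarrow> bool" where
  "quadratic_field K \<longleftrightarrow> (\<exists>d. squarefree d \<and> d \<noteq> 1 \<and> K = Qsqrt d)"

(* The componentwise product makes A ^ i meaningless here, so the powers of A
   are iterates of the matrix product; mat c is the scalar matrix c I. *)
definition matrix_poly :: "rat poly \<Rightarrow> rat^'n^'n \<Rightarrow> rat^'n^'n" where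
  "matrix_poly p A = (\<Sum>i\<le>degree p. mat (coeff p i) ** (((**) A) ^^ i) (mat 1))"

definition is_minpoly :: "rat^'n^'n \<Rightarrow> rat poly \<Rightarrow> bool" where
  "is_minpoly A p \<longleftrightarrow> lead_coeff p = 1 \<and> matrix_poly p A = 0 \<and>
     (\<forall>q. q \<noteq> 0 \<and> matrix_poly q A = 0 \<longrightarrow> degree p \<le> degree q)"

definition block_matrix ::
    "rat^2^2 \<Rightarrow> rat^2^2 \<Rightarrow> rat^2^2 \<Rightarrow> rat^2^2 \<Rightarrow> rat^4^4" where
  "block_matrix A1 A2 A3 A4 = vector
     [vector [A1$1$1, A1$1$2, A2$1$1, A2$1$2],
      vector [A1$2$1, A1$2$2, A2$2$1, A2$2$2],
      vector [A3$1$1, A3$1$2, A4$1$1, A4$1$2],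
      vector [A3$2$1, A3$2$2, A4$2$1, A4$2$2]]"

definition direct_sum :: "rat^2^2 \<Rightarrow> rat^2^2 \<Rightarrow> rat^4^4"  (infixl "\<oplus>\<^sub>m" 65) where
  "A \<oplus>\<^sub>m B = block_matrix A 0 0 B"

definition iota :: "rat^4^4" where
  "iota = mat 1 \<oplus>\<^sub>m (- mat 1)"

definition type_I :: "rat^4^4 \<Rightarrow> bool" where
  "type_I M \<longleftrightarrow> (\<exists>A1 A2 A3 A4. M = block_matrix A1 A2 A3 A4 \<and>
     A2 = 0 \<and> A3 = 0 \<and> det A1 = 1 \<and> det A4 = 1)"

definition GL4Q :: "(rat^4^4) monoid" where
  "GL4Q = \<lparr>carrier = {M. invertible M}, mult = (**), one = mat 1\<rparr>"

(* Germs at 0 are given by representing sets; sets with the same germ are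
   related by germ_eq; AutQ and ghol depend only on the germ of X. *)
definition germ_eq :: "(complex^4) set \<Rightarrow> (complex^4) set \<Rightarrow> bool" where
  "germ_eq X Y \<longleftrightarrow> (\<forall>\<^sub>F x in nhds 0. x \<in> X \<longleftrightarrow> x \<in> Y)"

definition AutQ :: "(complex^4) set \<Rightarrow> (rat^4^4) set" where
  "AutQ X = {M \<in> carrier GL4Q. germ_eq ((\<lambda>x. map_matrix of_rat M *v x) ` X) X}"

(* f is holomorphic on the polydisc of radius r about 0 in C^2, with Taylor
   coefficients c (c j k belongs to u1^j u2^k). *)
definition has_taylor ::
    "(complex \<Rightarrow> complex \<Rightarrow> complex) \<Rightarrow> (nat \<Rightarrow> nat \<Rightarrow> complex) \<Rightarrow> real \<Rightarrow> bool" where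
  "has_taylor f c r \<longleftrightarrow> (\<forall>u1 u2. norm u1 < r \<and> norm u2 < r \<longrightarrow>
     ((\<lambda>(j, k). c j k * u1 ^ j * u2 ^ k) has_sum f u1 u2) UNIV)"

definition only_odd_terms_ge3 :: "(nat \<Rightarrow> nat \<Rightarrow> complex) \<Rightarrow> bool" where
  "only_odd_terms_ge3 c \<longleftrightarrow> (\<forall>j k. c j k \<noteq> 0 \<longrightarrow> odd (j + k) \<and> j + k \<ge> 3)"

definition holonomy_graph ::
    "(complex \<Rightarrow> complex \<Rightarrow> complex) \<Rightarrow> (complex \<Rightarrow> complex \<Rightarrow> complex) \<Rightarrow> real \<Rightarrow>
     (complex^4) set" where
  "holonomy_graph v1 v2 r =
     {vector [u1, v1 u1 u2, u2, v2 u1 u2] | u1 u2. norm u1 < r \<and> norm u2 < r}"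

(* ghol X t1 t2: the germ of X is a generalized analytic holonomy set with cusp
   shapes t1, t2. The v_i, hence the cusp shapes, are determined by the germ of
   X, which is a graph over the (u1, u2)-plane. *)
definition ghol :: "(complex^4) set \<Rightarrow> complex \<Rightarrow> complex \<Rightarrow> bool" where
  "ghol X \<tau>1 \<tau>2 \<longleftrightarrow>
     (\<exists>v1 v2 c1 c2 r. r > 0 \<and> germ_eq X (holonomy_graph v1 v2 r) \<and>
        has_taylor (\<lambda>u1 u2. v1 u1 u2 - \<tau>1 * u1) c1 r \<and> only_odd_terms_ge3 c1 \<and>
        has_taylor (\<lambda>u1 u2. v2 u1 u2 - \<tau>2 * u2) c2 r \<and> only_odd_terms_ge3 c2 \<and>
        \<tau>1 \<notin> \<real> \<and> Im \<tau>1 > 0 \<and> \<tau>2 \<notin> \<real> \<and> Im \<tau>2 > 0 \<and>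
        (\<exists>u1. norm u1 < r \<and> v1 u1 0 \<noteq> \<tau>1 * u1) \<and>
        (\<exists>u2. norm u2 < r \<and> v2 0 u2 \<noteq> \<tau>2 * u2) \<and>
        (\<forall>u1 u2. norm u1 < r \<and> norm u2 < r \<longrightarrow>
           v1 (- u1) u2 = - v1 u1 u2 \<and> v1 u1 (- u2) = v1 u1 u2 \<and>
           v2 (- u1) u2 = v2 u1 u2 \<and> v2 u1 (- u2) = - v2 u1 u2) \<and>
        (\<exists>a. \<forall>u1 u2. norm u1 < r \<and> norm u2 < r \<longrightarrow>
           deriv (\<lambda>w. v1 u1 w) u2 = a * deriv (\<lambda>w. v2 w u2) u1)) \<and>
     (\<forall>H. subgroup H GL4Q \<and> H \<subseteq> AutQ X \<longrightarrow> finite H)"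

end

theory Submission
  imports Defs
begin

text \<open>The tangent space at \<open>0\<close> of \<open>X\<close> is spanned by \<open>(1, \<tau>1, 0, 0)\<close> and \<open>(0, 0, 1, \<tau>2)\<close>, so each
  diagonal block \<open>A\<close> of an automorphism of Type I has \<open>(1, \<tau>i)\<close> as an eigenvector. If \<open>A\<close> is not
  \<open>\<plusminus>I\<close>, the eigenvalue is not real, so \<open>\<bar>tr A\<bar> < 2\<close>. As \<open>AutQ X\<close> is itself a subgroup of \<open>GL4Q\<close>,
  it is finite; squaring acts on traces of determinant-one blocks by \<open>t \<mapsto> t\<^sup>2 - 2\<close>, which squares
  denominators, so \<open>tr A\<close> is an integer. Hence \<open>tr A\<close> is \<open>0\<close> or \<open>\<plusminus>1\<close>, and \<open>\<tau>i\<close> lies in the field of the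
  eigenvalue. The remaining assertions only use that the minimal polynomial \<open>x\<^sup>2 - (tr A) x + 1\<close>
  of a block other than \<open>\<plusminus>I\<close> divides that of \<open>M\<close>.\<close>

subsection \<open>Block sums and polynomials of matrices\<close>

lemma vector_4 [simp]:
  "(vector [x, y, z, w] :: 'a::zero^4) $ 1 = x"
  "(vector [x, y, z, w] :: 'a::zero^4) $ 2 = y"
  "(vector [x, y, z, w] :: 'a::zero^4) $ 3 = z"
  "(vector [x, y, z, w] :: 'a::zero^4) $ 4 = w"
  by (simp_all add: vector_def)

lemma direct_sum_nth [simp]:
  "(A \<oplus>\<^sub>m B) $ 1 = vector [A$1$1, A$1$2, 0, 0]"
  "(A \<oplus>\<^sub>m B) $ 2 = vector [A$2$1, A$2$2, 0, 0]"
  "(A \<oplus>\<^sub>m B) $ 3 = vector [0, 0, B$1$1, B$1$2]"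
  "(A \<oplus>\<^sub>m B) $ 4 = vector [0, 0, B$2$1, B$2$2]"
  by (simp_all add: direct_sum_def block_matrix_def)

lemma direct_sum_eq_iff: "A \<oplus>\<^sub>m B = C \<oplus>\<^sub>m D \<longleftrightarrow> A = C \<and> B = D"
  by (auto simp: vec_eq_iff forall_4 forall_2)

lemma direct_sum_mult: "(A \<oplus>\<^sub>m B) ** (C \<oplus>\<^sub>m D) = (A ** C) \<oplus>\<^sub>m (B ** D)"
  by (simp add: vec_eq_iff forall_4 matrix_matrix_mult_def sum_4 sum_2)

lemma direct_sum_add: "(A \<oplus>\<^sub>m B) + (C \<oplus>\<^sub>m D) = (A + C) \<oplus>\<^sub>m (B + D)"
  by (simp add: vec_eq_iff forall_4)

lemma direct_sum_signs:
  "mat 1 \<oplus>\<^sub>m mat 1 = mat 1" "(- mat 1) \<oplus>\<^sub>m (- mat 1) = - mat 1"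
  "mat 1 \<oplus>\<^sub>m (- mat 1) = iota" "(- mat 1) \<oplus>\<^sub>m mat 1 = - iota"
  by (simp_all add: vec_eq_iff forall_4 iota_def mat_def)

lemma direct_sum_mat: "mat c \<oplus>\<^sub>m mat c = mat c"
  by (simp add: vec_eq_iff forall_4 mat_def)

lemma direct_sum_zero: "0 \<oplus>\<^sub>m 0 = 0"
  by (simp add: vec_eq_iff forall_4)

lemma type_I_iff: "type_I M \<longleftrightarrow> (\<exists>A B. M = A \<oplus>\<^sub>m B \<and> det A = 1 \<and> det B = 1)"
  by (auto simp: type_I_def direct_sum_def)

lemma mat_mult_nth: "(mat c ** A) $ i $ j = c * A $ i $ j"
  by (simp add: matrix_matrix_mult_def mat_def if_distrib[of "\<lambda>x. x * _"] cong: if_cong)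

lemma mult_mat_nth: "(A ** mat c) $ i $ j = A $ i $ j * c"
  by (simp add: matrix_matrix_mult_def mat_def if_distrib[of "\<lambda>x. _ * x"] cong: if_cong)

lemma mat_add: "mat (a + b) = (mat a + mat b :: 'a::monoid_add^'n^'n)"
  by (simp add: vec_eq_iff mat_def)

lemma mat_mult_commute:
  fixes A :: "'a::comm_semiring_1^'n^'n"
  shows "mat c ** A = A ** mat c"
  by (simp add: vec_eq_iff mat_mult_nth mult_mat_nth mult.commute)

lemma matrix_mult_sum_right:
  fixes A :: "'a::semiring_1^'n^'m" and B :: "'i \<Rightarrow> 'a^'p^'n"
  shows "A ** (\<Sum>i\<in>I. B i) = (\<Sum>i\<in>I. A ** B i)"
proof -
  have "A ** 0 = (0 :: 'a^'p^'m)" by (simp add: vec_eq_iff matrix_matrix_mult_def)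
  then show ?thesis
    by (induction I rule: infinite_finite_induct) (simp_all add: matrix_add_ldistrib)
qed

lemma mat_mult_mat:
  fixes c d :: "'a::semiring_1"
  shows "mat c ** mat d = (mat (c * d) :: 'a^'n^'n)"
  unfolding vec_eq_iff mat_mult_nth by (simp add: mat_def)

lemma matrix_poly_0 [simp]: "matrix_poly 0 A = 0"
  by (simp add: matrix_poly_def vec_eq_iff mat_mult_nth)

text \<open>Horner's rule. It replaces the sum over powers by a recursion, so that the laws of
  polynomial evaluation follow by induction on the coefficient list; the scalar factors can be moved
  past \<open>A\<close> because they commute with it.\<close>

lemma matrix_poly_pCons: "matrix_poly (pCons a p) A = mat a + A ** matrix_poly p A"
proof (cases "p = 0")
  \<comment> \<open>For \<open>p = 0\<close> the degree of \<open>pCons a p\<close> stays 0 instead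
    of growing by one, so the index shift of the other case does not apply.\<close>
  case True
  then show ?thesis by (simp add: matrix_poly_def)
next
  case False
  have "matrix_poly (pCons a p) A =
      mat a + (\<Sum>i\<le>degree p. mat (coeff p i) ** (A ** (((**) A) ^^ i) (mat 1)))"
    using False by (simp add: matrix_poly_def sum.atMost_Suc_shift del: sum.atMost_Suc)
  also have "(\<Sum>i\<le>degree p. mat (coeff p i) ** (A ** (((**) A) ^^ i) (mat 1))) =
      A ** matrix_poly p A"
    by (simp add: matrix_poly_def matrix_mult_sum_right matrix_mul_assoc mat_mult_commute[of _ A])
  finally show ?thesis .
qed

lemma matrix_add_rdistrib:
  fixes A B :: "'a::semiring_1^'n^'m"
  shows "(A + B) ** C = A ** C + B ** C"
  by (simp add: vec_eq_iff matrix_matrix_mult_def distrib_right sum.distrib)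

lemma matrix_poly_add: "matrix_poly (p + q) A = matrix_poly p A + matrix_poly q A"
proof (induction p q rule: poly_induct2)
  case (pCons a p b q)
  then show ?case
    by (simp add: matrix_poly_pCons matrix_add_ldistrib mat_add algebra_simps)
qed simp

lemma matrix_poly_smult: "matrix_poly (smult c p) A = mat c ** matrix_poly p A"
proof (induction p)
  case (pCons a p)
  have "A ** (mat c ** B) = mat c ** (A ** B)" for B
    by (simp add: matrix_mul_assoc mat_mult_commute)
  then show ?case
    by (simp add: matrix_poly_pCons matrix_add_ldistrib pCons mat_mult_mat)
qed simp

lemma matrix_poly_mult: "matrix_poly (p * q) A = matrix_poly p A ** matrix_poly q A"
proof (induction p)
  case (pCons a p)
  \<comment> \<open>The recursion for products adds \<open>pCons 0 (p * q)\<close>, whose constant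
    coefficient turns into \<open>mat 0\<close> under Horner's rule.\<close>
  have "mat 0 = (0 :: rat^'a^'a)" by (simp add: vec_eq_iff mat_def)
  then show ?case
    by (simp add: matrix_poly_pCons matrix_poly_add matrix_poly_smult pCons
        matrix_add_rdistrib matrix_mul_assoc)
qed simp

text \<open>Sums, products and scalar matrices all split blockwise. Hence a polynomial annihilates a
  block sum exactly when it annihilates both blocks.\<close>

lemma matrix_poly_direct_sum:
  "matrix_poly p (A \<oplus>\<^sub>m B) = matrix_poly p A \<oplus>\<^sub>m matrix_poly p B"
  by (induction p)
    (simp_all add: direct_sum_zero matrix_poly_pCons direct_sum_mult
      flip: direct_sum_add direct_sum_mat)

lemma matrix_poly_mat: "matrix_poly p (mat c) = mat (poly p c)"
  proof (induction p)
  case 0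
  show ?case by (simp add: vec_eq_iff mat_def)
qed (simp add: matrix_poly_pCons mat_mult_mat mat_add)

text \<open>The remainder of \<open>p\<close> modulo \<open>m\<close> also annihilates
  \<open>A\<close>, and a nonzero remainder would have smaller degree than \<open>m\<close>.\<close>

lemma is_minpoly_dvd:
  assumes "is_minpoly A m" "matrix_poly p A = 0"
  shows "m dvd p"
proof (rule ccontr)
  assume "\<not> m dvd p"
  then have nz: "p mod m \<noteq> 0" by (simp add: dvd_eq_mod_eq_0)
  have "m \<noteq> 0" using assms(1) by (auto simp: is_minpoly_def)
  have "matrix_poly p A = matrix_poly (m * (p div m) + p mod m) A" by simp
  also have "\<dots> = matrix_poly (p mod m) A"
    using assms(1) unfolding matrix_poly_add matrix_poly_mult by (simp add: is_minpoly_def)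
  finally have "degree m \<le> degree (p mod m)"
    using assms nz by (simp add: is_minpoly_def)
  with degree_mod_less[OF \<open>m \<noteq> 0\<close>, of p] nz show False by simp
qed

subsection \<open>Determinant-one matrices of size two\<close>

lemma scalar_det_1:
  fixes A :: "'a::idom^2^2"
  assumes "det A = 1" "A$1$2 = 0" "A$2$1 = 0" "A$1$1 = A$2$2"
  shows "A = mat 1 \<or> A = - mat 1"
proof -
  have "A$1$1 * A$1$1 = 1" using assms by (simp add: det_2)
  then have "A$1$1 = 1 \<or> A$1$1 = -1" by (simp add: square_eq_1_iff)
  then show ?thesis using assms by (auto simp: vec_eq_iff forall_2 mat_def)
qed

text \<open>Cayley-Hamilton shows that the polynomial annihilates \<open>A\<close>. A nonzero
  annihilator of degree at most one would make \<open>A\<close> scalar, and the only scalar matrices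
  of determinant one are the two excluded ones.\<close>

lemma is_minpoly_det_1:
  fixes A :: "rat^2^2"
  assumes det: "det A = 1" and ns: "A \<noteq> mat 1" "A \<noteq> - mat 1"
  shows "is_minpoly A [:1, - trace A, 1:]"
  unfolding is_minpoly_def
proof (intro conjI allI impI)
  show "matrix_poly [:1, - trace A, 1:] A = 0"
    using det
    by (simp add: matrix_poly_pCons vec_eq_iff forall_2 matrix_matrix_mult_def sum_2 mat_def
        det_2 trace_def algebra_simps)
next
  fix q assume q: "q \<noteq> 0 \<and> matrix_poly q A = 0"
  show "degree [:1, - trace A, 1:] \<le> degree q"
  proof (rule ccontr)
    assume "\<not> ?thesis"
    then have "degree q \<le> 1" by simp
    then obtain c b where qe: "q = [:c, b:]" by (metis degree1_coeffs degree_0_id less_one nat_less_le pCons_0_0)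
    have e: "c + A$1$1 * b = 0" "A$1$2 * b = 0" "A$2$1 * b = 0" "c + A$2$2 * b = 0"
      using q by (simp_all add: qe matrix_poly_pCons vec_eq_iff forall_2 matrix_matrix_mult_def
          sum_2 mat_def)
    have "b \<noteq> 0" using e q by (auto simp: qe)
    then have "A$1$2 = 0" "A$2$1 = 0" using e by auto
    moreover have "A$1$1 = A$2$2"
      using e(1,4) \<open>b \<noteq> 0\<close> by (metis add_left_cancel mult_cancel_right)
    ultimately show False using scalar_det_1[OF det] ns by blast
  qed
qed simp

text \<open>The two expressions are the coefficients of the remainder modulo x^2 - s x + 1, found by
  reducing x^2 to s x - 1, x^3 to (s^2 - 1) x - s and x^4 to (s^3 - 2 s) x - (s^2 - 1). The leading
  coefficients may vanish, so quadratics and cubics are covered too.\<close>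

lemma monic_quadratic_dvd_quartic:
  fixes s :: "'a::field"
  assumes "[:1, -s, 1:] dvd [:c0, c1, c2, c3, c4:]"
  shows "c0 - c2 - c3 * s - c4 * (s^2 - 1) = 0"
    and "c1 + c2 * s + c3 * (s^2 - 1) + c4 * (s^3 - 2 * s) = 0"
proof -
  define r where "r = [:c0 - c2 - c3 * s - c4 * (s^2 - 1),
    c1 + c2 * s + c3 * (s^2 - 1) + c4 * (s^3 - 2 * s):]"
  have "[:c0, c1, c2, c3, c4:] =
      [:1, -s, 1:] * [:c2 - c4 + s * (c3 + c4 * s), c3 + c4 * s, c4:] + r"
    by (simp add: r_def algebra_simps power2_eq_square power3_eq_cube)
  with assms have "[:1, -s, 1:] dvd r"
    by (metis dvd_add_right_iff dvd_triv_left)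
  moreover have "degree r < degree [:1, -s, 1:]"
    by (simp add: r_def)
  ultimately have "r = 0"
    using dvd_imp_degree_le leD by blast
  then show "c0 - c2 - c3 * s - c4 * (s^2 - 1) = 0"
    and "c1 + c2 * s + c3 * (s^2 - 1) + c4 * (s^3 - 2 * s) = 0"
    by (simp_all add: r_def)
qed

lemma trace_squared_det_1:
  fixes A :: "'a::comm_ring_1^2^2"
  assumes "det A = 1"
  shows "trace (A ** A) = (trace A)^2 - 2"
proof -
  have "trace (A ** A) = (trace A)^2 - 2 * det A"
    by (simp add: trace_def sum_2 matrix_matrix_mult_def det_2 power2_eq_square algebra_simps)
  with assms show ?thesis by simp
qed

subsection \<open>Integrality of traces\<close>

text \<open>For s = p/q in lowest terms, (p^2 - 2 q^2) / q^2 is again in lowest terms: subtracting a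
  multiple of q^2 does not change the gcd of p^2 with q^2.\<close>

lemma denominator_square_minus_2:
  "snd (quotient_of (s^2 - 2)) = (snd (quotient_of s))^2"
proof -
  obtain p q where pq: "quotient_of s = (p, q)" by force
  have q: "q > 0" and c: "coprime p q" and s: "s = of_int p / of_int q"
    using quotient_of_denom_pos[OF pq] quotient_of_coprime[OF pq] quotient_of_div[OF pq] by auto
  have "s^2 - 2 = Fract (p^2 - 2 * q^2) (q^2)"
    using q by (simp add: s Fract_of_int_quotient field_simps)
  moreover have "coprime (p^2 - 2 * q^2) (q^2)"
  proof -
    have "gcd (p^2 - 2 * q^2) (q^2) = gcd (p^2) (q^2)"
      by (metis gcd_add_mult gcd.commute diff_add_cancel add.commute)
    then show ?thesis using c by (simp add: coprime_iff_gcd_eq_1)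
  qed
  ultimately show ?thesis
    using q by (simp add: quotient_of_Fract Rat.normalize_def pq)
qed

text \<open>The largest denominator D occurring in \<open>S\<close> satisfies D^2 \<le> D, because
  its square is again a denominator. Therefore all denominators are 1.\<close>

lemma finite_square_minus_2_closed_Ints:
  fixes S :: "rat set"
  assumes "finite S" "t \<in> S" "\<And>s. s \<in> S \<Longrightarrow> s^2 - 2 \<in> S"
  shows "t \<in> \<int>"
proof -
  define D where "D = (\<lambda>s. snd (quotient_of s)) ` S"
  have D: "finite D" "D \<noteq> {}" using assms by (auto simp: D_def)
  have "Max D \<in> D" using D by (rule Max_in)
  then obtain s where s: "s \<in> S" "Max D = snd (quotient_of s)" by (auto simp: D_def)
  have "snd (quotient_of (s^2 - 2)) \<in> D" using s assms(3) by (auto simp: D_def)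
  then have "(Max D)^2 \<le> Max D"
    using D by (simp add: denominator_square_minus_2 s(2)[symmetric])
  moreover have "Max D > 0" using s quotient_of_denom_pos' by simp
  ultimately have "Max D \<le> 1" by (simp add: power2_eq_square)
  moreover have "snd (quotient_of t) \<in> D" using assms by (auto simp: D_def)
  ultimately have "snd (quotient_of t) \<le> 1" using D Max_ge order_trans by metis
  with quotient_of_denom_pos'[of t] have "snd (quotient_of t) = 1" by linarith
  then have "t = of_int (fst (quotient_of t))"
    by (metis div_by_1 of_int_1 prod.collapse quotient_of_div)
  then show ?thesis by (metis Ints_of_int)
qed

subsection \<open>The automorphism group of a germ\<close>

lemma map_matrix_of_rat_mult:
  "map_matrix of_rat (M ** N) = (map_matrix of_rat M ** map_matrix of_rat N :: 'a::field_char_0^'n^'n)"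
  by (simp add: vec_eq_iff matrix_matrix_mult_def of_rat_sum of_rat_mult)

lemma map_matrix_of_rat_mat: "map_matrix of_rat (mat c) = mat (of_rat c)"
  by (simp add: vec_eq_iff mat_def)

lemma tendsto_matrix_vector_mult:
  fixes A :: "'a::{real_normed_algebra_1}^'n^'m"
  assumes "(f \<longlongrightarrow> x) F"
  shows "((\<lambda>u. A *v f u) \<longlongrightarrow> A *v x) F"
  unfolding matrix_vector_mult_def
  by (intro vec_tendstoI) (auto intro!: tendsto_intros assms)

lemma germ_eq_refl: "germ_eq X X"
  by (simp add: germ_eq_def)

lemma germ_eq_sym: "germ_eq X Y \<Longrightarrow> germ_eq Y X"
  by (simp add: germ_eq_def eq_commute)

lemma germ_eq_trans: "germ_eq X Y \<Longrightarrow> germ_eq Y Z \<Longrightarrow> germ_eq X Z"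
  unfolding germ_eq_def by (erule (1) eventually_elim2) simp

text \<open>A point lies in the image under \<open>A\<close> iff its image under the inverse
  \<open>B\<close> lies in the original set. As \<open>B\<close> is continuous and fixes 0,
  agreement near 0 can be pulled back along it.\<close>

lemma germ_eq_image:
  assumes inv: "A ** B = mat 1" "B ** A = mat 1" and "germ_eq X Y"
  shows "germ_eq ((*v) A ` X) ((*v) A ` Y)"
proof -
  have im: "x \<in> (*v) A ` Z \<longleftrightarrow> B *v x \<in> Z" for x Z
    using inv by (metis (no_types, lifting) image_iff matrix_vector_mul_assoc matrix_vector_mul_lid)
  have "filterlim ((*v) B) (nhds 0) (nhds 0)"
    using tendsto_matrix_vector_mult[OF filterlim_ident, of B 0] by simp
  with assms(3) show ?thesis
    unfolding germ_eq_def im by (rule eventually_compose_filterlim)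
qed

lemma group_GL4Q: "group GL4Q"
proof (rule groupI)
  fix M N assume "M \<in> carrier GL4Q" "N \<in> carrier GL4Q"
  then show "M \<otimes>\<^bsub>GL4Q\<^esub> N \<in> carrier GL4Q" by (simp add: GL4Q_def invertible_mult)
qed (auto simp: GL4Q_def matrix_mul_assoc invertible_def)

lemma AutQ_mult:
  assumes "M \<in> AutQ X" "N \<in> AutQ X"
  shows "M ** N \<in> AutQ X"
proof -
  let ?L = "\<lambda>M. map_matrix of_rat M :: complex^4^4"
  obtain M' where M': "M ** M' = mat 1" "M' ** M = mat 1"
    using assms by (auto simp: AutQ_def GL4Q_def invertible_def)
  have inv: "?L M ** ?L M' = mat 1" "?L M' ** ?L M = mat 1"
    using M' by (simp_all flip: map_matrix_of_rat_mult add: map_matrix_of_rat_mat)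
  have "germ_eq ((*v) (?L M) ` ((*v) (?L N) ` X)) ((*v) (?L M) ` X)"
    using inv assms by (intro germ_eq_image) (auto simp: AutQ_def)
  moreover have "germ_eq ((*v) (?L M) ` X) X"
    using assms by (simp add: AutQ_def)
  ultimately have "germ_eq ((*v) (?L (M ** N)) ` X) X"
    using germ_eq_trans
    by (simp add: image_image matrix_vector_mul_assoc map_matrix_of_rat_mult)
  with assms show ?thesis
    by (auto simp: AutQ_def GL4Q_def intro: invertible_mult)
qed

text \<open>This lets the finiteness clause of \<open>ghol\<close> be applied to
  \<open>AutQ X\<close> itself.\<close>

lemma subgroup_AutQ: "subgroup (AutQ X) GL4Q"
proof (rule group.subgroupI[OF group_GL4Q])
  show "AutQ X \<subseteq> carrier GL4Q" by (auto simp: AutQ_def)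
  have "mat 1 \<in> AutQ X"
    by (auto simp: AutQ_def GL4Q_def map_matrix_of_rat_mat germ_eq_refl invertible_def)
  then show "AutQ X \<noteq> {}" by blast
next
  let ?L = "\<lambda>M. map_matrix of_rat M :: complex^4^4"
  fix M assume M: "M \<in> AutQ X"
  then obtain N where N: "M ** N = mat 1" "N ** M = mat 1"
    by (auto simp: AutQ_def GL4Q_def invertible_def)
  have inv: "?L M ** ?L N = mat 1" "?L N ** ?L M = mat 1"
    using N by (simp_all flip: map_matrix_of_rat_mult add: map_matrix_of_rat_mat)
  \<comment> \<open>Applying the inverse \<open>N\<close> to both sides of the germ identity M X = X
    yields X = N X.\<close>
  have "germ_eq ((*v) (?L N) ` ((*v) (?L M) ` X)) ((*v) (?L N) ` X)"
    using inv M by (intro germ_eq_image) (auto simp: AutQ_def)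
  then have "germ_eq ((*v) (?L N) ` X) X"
    by (simp add: image_image matrix_vector_mul_assoc inv germ_eq_sym)
  then have "N \<in> AutQ X"
    using N by (auto simp: AutQ_def GL4Q_def invertible_def)
  moreover have "inv\<^bsub>GL4Q\<^esub> M = N"
    using M N by (intro group.inv_equality[OF group_GL4Q]) (auto simp: AutQ_def GL4Q_def invertible_def)
  ultimately show "inv\<^bsub>GL4Q\<^esub> M \<in> AutQ X" by simp
next
  fix M N assume "M \<in> AutQ X" "N \<in> AutQ X"
  then show "M \<otimes>\<^bsub>GL4Q\<^esub> N \<in> AutQ X"
    using AutQ_mult by (simp add: GL4Q_def)
qed

text \<open>Squaring an automorphism squares its blocks, which replaces each trace s by s^2 - 2. The
  traces of either block thus range over a finite set closed under this map.\<close>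

lemma block_trace_Ints:
  assumes "finite (AutQ X)" "A \<oplus>\<^sub>m B \<in> AutQ X" "det A = 1" "det B = 1"
  shows "trace A \<in> \<int>" "trace B \<in> \<int>"
proof -
  \<comment> \<open>Pairs are collected because only both blocks together form an automorphism;
    squaring has to act on them simultaneously.\<close>
  let ?P = "{(A, B). A \<oplus>\<^sub>m B \<in> AutQ X \<and> det A = 1 \<and> det B = 1}"
  have "inj_on (\<lambda>(A, B). A \<oplus>\<^sub>m B) ?P"
    by (auto simp: inj_on_def direct_sum_eq_iff)
  moreover have "(\<lambda>(A, B). A \<oplus>\<^sub>m B) ` ?P \<subseteq> AutQ X" by auto
  ultimately have fin: "finite ?P"
    using assms(1) by (meson finite_imageD finite_subset)
  have sq: "(C ** C, D ** D) \<in> ?P" if "(C, D) \<in> ?P" for C D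
    using that AutQ_mult[of "C \<oplus>\<^sub>m D" X "C \<oplus>\<^sub>m D"] by (auto simp: direct_sum_mult det_mul)
  show "trace A \<in> \<int>"
  proof (rule finite_square_minus_2_closed_Ints)
    show "finite ((\<lambda>(A, B). trace A) ` ?P)" using fin by blast
    show "trace A \<in> (\<lambda>(A, B). trace A) ` ?P" using assms by force
    show "s^2 - 2 \<in> (\<lambda>(A, B). trace A) ` ?P" if "s \<in> (\<lambda>(A, B). trace A) ` ?P" for s
      using that sq by (force simp: trace_squared_det_1[symmetric])
  qed
  show "trace B \<in> \<int>"
  proof (rule finite_square_minus_2_closed_Ints)
    show "finite ((\<lambda>(A, B). trace B) ` ?P)" using fin by blast
    show "trace B \<in> (\<lambda>(A, B). trace B) ` ?P" using assms by force
    show "s^2 - 2 \<in> (\<lambda>(A, B). trace B) ` ?P" if "s \<in> (\<lambda>(A, B). trace B) ` ?P" for s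
      using that sq by (force simp: trace_squared_det_1[symmetric])
  qed
qed

subsection \<open>Tangent spaces\<close>

text \<open>Every monomial has total degree above 2, so shrinking both variables by a factor \<rho>
  \<le> 1 shrinks each term at least by \<rho>^2. Termwise comparison with the absolutely convergent
  series at the corner (r/2, r/2) gives the bound.\<close>

lemma has_taylor_quadratic_bound:
  assumes tay: "has_taylor f c r" and odd: "only_odd_terms_ge3 c" and r: "r > 0"
  obtains C where
    "\<And>u1 u2 \<rho>. 0 \<le> \<rho> \<Longrightarrow> \<rho> \<le> 1 \<Longrightarrow> norm u1 \<le> \<rho> * (r / 2) \<Longrightarrow> norm u2 \<le> \<rho> * (r / 2) \<Longrightarrow>
      norm (f u1 u2) \<le> C * \<rho>^2"
proof -
  define t where "t = (\<lambda>u1 u2 (j, k). c j k * u1 ^ j * u2 ^ k)"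
  have hs: "(t u1 u2 has_sum f u1 u2) UNIV" if "norm u1 < r" "norm u2 < r" for u1 u2
    using tay that by (simp add: has_taylor_def t_def)
  have abs: "(\<lambda>x. norm (t u1 u2 x)) summable_on UNIV" if "norm u1 < r" "norm u2 < r" for u1 u2
    using hs[OF that] summable_on_iff_abs_summable_on_complex has_sum_imp_summable by blast
  \<comment> \<open>Half the radius keeps the comparison point strictly inside the polydisc, where
    the series converges absolutely.\<close>
  define s where "s = r / 2"
  define C where "C = (\<Sum>\<^sub>\<infinity>x. norm (t (of_real s) (of_real s) x))"
  have s: "0 < s" "s < r" using r by (auto simp: s_def)
  have C: "((\<lambda>x. norm (t (of_real s) (of_real s) x)) has_sum C) UNIV"
    unfolding C_def using s by (intro has_sum_infsum abs) auto
  show thesis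
  proof (rule that)
    fix u1 u2 :: complex and \<rho> :: real
    assume \<rho>: "0 \<le> \<rho>" "\<rho> \<le> 1" and u: "norm u1 \<le> \<rho> * (r / 2)" "norm u2 \<le> \<rho> * (r / 2)"
    have "\<rho> * s \<le> s" using \<rho> s by (simp add: mult_left_le_one_le)
    then have u': "norm u1 < r" "norm u2 < r" using u s unfolding s_def by linarith+
    have le: "norm (t u1 u2 x) \<le> norm (t (of_real s) (of_real s) x) * \<rho>^2" for x
    proof -
      obtain j k where x: "x = (j, k)" by force
      show ?thesis
      proof (cases "c j k = 0")
        case False
        then have jk: "2 \<le> j + k" using odd by (force simp: only_odd_terms_ge3_def)
        have "norm u1 ^ j * norm u2 ^ k \<le> (\<rho> * s) ^ j * (\<rho> * s) ^ k"
          using u \<rho> s by (intro mult_mono power_mono) (auto simp: s_def)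
        also have "\<dots> = s ^ j * s ^ k * \<rho> ^ (j + k)"
          by (simp add: power_mult_distrib power_add)
        also have "\<dots> \<le> s ^ j * s ^ k * \<rho>^2"
          using \<rho> s jk by (intro mult_left_mono power_decreasing) auto
        finally have "norm (c j k) * (norm u1 ^ j * norm u2 ^ k) \<le>
            norm (c j k) * (s ^ j * s ^ k * \<rho>^2)"
          by (rule mult_left_mono) simp
        then show ?thesis
          using s by (simp add: x t_def norm_mult norm_power mult_ac)
      qed (simp add: x t_def)
    qed
    have sm: "((\<lambda>x. norm (t u1 u2 x)) has_sum (\<Sum>\<^sub>\<infinity>x. norm (t u1 u2 x))) UNIV"
      using u' by (intro has_sum_infsum abs)
    have "norm (f u1 u2) \<le> (\<Sum>\<^sub>\<infinity>x. norm (t u1 u2 x))"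
      using sm hs[OF u'] by (rule norm_has_sum_bound)
    also have "\<dots> \<le> C * \<rho>^2"
      using sm has_sum_cmult_left[OF C] le by (rule has_sum_mono)
    finally show "norm (f u1 u2) \<le> C * \<rho>^2" .
  qed
qed

text \<open>The bound gives \<open>g 0 = 0\<close>, and near 0 the difference quotient
  \<open>g u / u\<close> is at most \<open>C * norm u\<close>.\<close>

lemma quadratic_bound_imp_deriv_0:
  fixes g :: "complex \<Rightarrow> complex"
  assumes "s > 0" "\<And>u. norm u \<le> s \<Longrightarrow> norm (g u) \<le> C * (norm u)^2"
  shows "(g has_field_derivative 0) (at 0)"
proof -
  have g0: "g 0 = 0" using assms(1) assms(2)[of 0] by simp
  have "((\<lambda>u. g u / u) \<longlongrightarrow> 0) (at 0)"
  proof (rule Lim_null_comparison)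
    have "\<forall>\<^sub>F u in at (0::complex). norm u < s"
      using assms(1) by (auto simp: eventually_at intro!: exI[of _ s])
    then show "\<forall>\<^sub>F u in at 0. norm (g u / u) \<le> C * norm u"
    proof eventually_elim
      case (elim u)
      then show ?case
        using assms(2)[of u]
        by (cases "u = 0") (auto simp: g0 norm_divide divide_simps power2_eq_square mult_ac)
    qed
    show "((\<lambda>u::complex. C * norm u) \<longlongrightarrow> 0) (at 0)"
      by (auto intro!: tendsto_eq_intros)
  qed
  then show "(g has_field_derivative 0) (at 0)"
    by (simp add: has_field_derivative_iff g0)
qed

lemma has_taylor_deriv_axes:
  assumes "has_taylor f c r" "only_odd_terms_ge3 c" "r > 0"
  shows "((\<lambda>u. f u 0) has_field_derivative 0) (at 0)"
    "((\<lambda>u. f 0 u) has_field_derivative 0) (at 0)"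
proof -
  obtain C where C: "\<And>u1 u2 \<rho>. 0 \<le> \<rho> \<Longrightarrow> \<rho> \<le> 1 \<Longrightarrow> norm u1 \<le> \<rho> * (r / 2) \<Longrightarrow>
      norm u2 \<le> \<rho> * (r / 2) \<Longrightarrow> norm (f u1 u2) \<le> C * \<rho>^2"
    using has_taylor_quadratic_bound[OF assms] by blast
  \<comment> \<open>A point \<open>u\<close> on an axis has scaling factor
    \<open>norm u / (r / 2)\<close>; squaring it leaves this constant in front of the square of
    \<open>norm u\<close>.\<close>
  define D where "D = C / (r / 2)^2"
  have "norm (f u 0) \<le> D * (norm u)^2" "norm (f 0 u) \<le> D * (norm u)^2"
    if "norm u \<le> r / 2" for u
    using C[of "norm u / (r / 2)" u 0] C[of "norm u / (r / 2)" 0 u] that assms(3)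
    unfolding D_def by (auto simp: field_simps)
  then show "((\<lambda>u. f u 0) has_field_derivative 0) (at 0)"
    "((\<lambda>u. f 0 u) has_field_derivative 0) (at 0)"
    using quadratic_bound_imp_deriv_0[of "r / 2" "\<lambda>u. f u 0" D]
      quadratic_bound_imp_deriv_0[of "r / 2" "\<lambda>u. f 0 u" D] assms(3) by auto
qed

text \<open>Close to 0, a point of \<open>G\<close> lies in \<open>X\<close>, its image under
  \<open>L\<close> lies in the image of \<open>X\<close>, hence in \<open>X\<close>, hence in
  \<open>G\<close>. Each passage holds eventually because both \<open>p\<close> and its image tend
  to 0.\<close>

lemma germ_preserved_along:
  fixes L :: "complex^4^4"
  assumes "germ_eq X G" "germ_eq ((*v) L ` X) X" "(p \<longlongrightarrow> 0) F" "\<forall>\<^sub>F u in F. p u \<in> G"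
  shows "\<forall>\<^sub>F u in F. L *v p u \<in> G"
proof -
  have Lp: "((\<lambda>u. L *v p u) \<longlongrightarrow> 0) F"
    using tendsto_matrix_vector_mult[OF assms(3), of L] by simp
  show ?thesis
    using eventually_compose_filterlim[OF assms(1)[unfolded germ_eq_def] assms(3)]
      eventually_compose_filterlim[OF assms(1)[unfolded germ_eq_def] Lp]
      eventually_compose_filterlim[OF assms(2)[unfolded germ_eq_def] Lp] assms(4)
    by eventually_elim blast
qed

text \<open>Both sides of the functional equation are differentiated at 0. Geometrically, the matrix
  with rows (a, b) and (c, d) maps the tangent direction (1, \<tau>) of the graph of
  \<open>h\<close> to a multiple of itself.\<close>

lemma tangent_slope_invariant:
  fixes h :: "complex \<Rightarrow> complex"
  assumes h: "(h has_field_derivative \<tau>) (at 0)" "h 0 = 0"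
    and inv: "\<forall>\<^sub>F u in nhds 0. c * u + d * h u = h (a * u + b * h u)"
  shows "c + d * \<tau> = \<tau> * (a + b * \<tau>)"
proof -
  have "((\<lambda>u. c * u + d * h u) has_field_derivative c + d * \<tau>) (at 0)"
    by (auto intro!: derivative_eq_intros h)
  moreover have "((\<lambda>u. a * u + b * h u) has_field_derivative a + b * \<tau>) (at 0)"
    by (auto intro!: derivative_eq_intros h)
  then have "((\<lambda>u. h (a * u + b * h u)) has_field_derivative \<tau> * (a + b * \<tau>)) (at 0)"
    using h by (intro DERIV_chain2[where f = h]) auto
  ultimately show ?thesis
    using DERIV_cong_ev[OF refl inv refl] DERIV_unique by blast
qed

text \<open>By parity, \<open>X\<close> contains a curve inside each of the two coordinate planes,
  namely the graphs of \<open>v1 u 0\<close> and \<open>v2 0 u\<close>. A block sum preserves these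
  planes, so each block preserves its curve and the tangent line of that curve.\<close>

lemma ghol_block_tangent:
  assumes "ghol X \<tau>1 \<tau>2" "A \<oplus>\<^sub>m B \<in> AutQ X"
  shows "of_rat (A$2$1) + of_rat (A$2$2) * \<tau>1 = \<tau>1 * (of_rat (A$1$1) + of_rat (A$1$2) * \<tau>1)"
    and "of_rat (B$2$1) + of_rat (B$2$2) * \<tau>2 = \<tau>2 * (of_rat (B$1$1) + of_rat (B$1$2) * \<tau>2)"
proof -
  obtain v1 v2 c1 c2 r where G: "germ_eq X (holonomy_graph v1 v2 r)" and r: "r > 0"
    and t1: "has_taylor (\<lambda>u1 u2. v1 u1 u2 - \<tau>1 * u1) c1 r" "only_odd_terms_ge3 c1"
    and t2: "has_taylor (\<lambda>u1 u2. v2 u1 u2 - \<tau>2 * u2) c2 r" "only_odd_terms_ge3 c2"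
    and par: "\<And>u1 u2. norm u1 < r \<and> norm u2 < r \<Longrightarrow>
      v1 (- u1) u2 = - v1 u1 u2 \<and> v2 u1 (- u2) = - v2 u1 u2"
  proof -
    from assms(1) show thesis
      unfolding ghol_def by (elim conjE exE) (rule that, (assumption | simp)+)
  qed
  let ?L = "map_matrix of_rat (A \<oplus>\<^sub>m B) :: complex^4^4"
  have L: "germ_eq ((*v) ?L ` X) X"
    using assms(2) by (simp add: AutQ_def)
  \<comment> \<open>An odd function vanishes at 0; this is what places the two curves inside the
    coordinate planes.\<close>
  have v10: "v1 0 u = 0" and v20: "v2 u 0 = 0" if "norm u < r" for u
    using par[of 0 u] par[of u 0] that r by auto
  have small: "\<forall>\<^sub>F u in nhds (0::complex). norm u < r"
    using r by (auto simp: eventually_nhds_metric)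
  have nth: "vector [a, b, c, d] = (vector [a', b', c', d'] :: complex^4) \<longleftrightarrow>
      a = a' \<and> b = b' \<and> c = c' \<and> d = d'" for a b c d a' b' c' d'
    by (auto simp: vec_eq_iff forall_4)
  have d1: "((\<lambda>u. v1 u 0) has_field_derivative \<tau>1) (at 0)"
    using DERIV_add[OF has_taylor_deriv_axes(1)[OF t1 r] DERIV_cmult_Id[of \<tau>1]] by simp
  have d2: "((\<lambda>u. v2 0 u) has_field_derivative \<tau>2) (at 0)"
    using DERIV_add[OF has_taylor_deriv_axes(2)[OF t2 r] DERIV_cmult_Id[of \<tau>2]] by simp
  have lim: "(h \<longlongrightarrow> 0) (nhds 0)" if "(h has_field_derivative \<tau>) (at 0)" "h 0 = 0"
    for h :: "complex \<Rightarrow> complex" and \<tau>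
    using DERIV_isCont[OF that(1)] that(2) by (simp add: isCont_def tendsto_nhds_iff)
  have e1: "\<forall>\<^sub>F u in nhds 0. ?L *v vector [u, v1 u 0, 0, 0] \<in> holonomy_graph v1 v2 r"
  proof (rule germ_preserved_along[OF G L])
    show "((\<lambda>u. vector [u, v1 u 0, 0, 0] :: complex^4) \<longlongrightarrow> 0) (nhds 0)"
    proof (rule vec_tendstoI)
      show "((\<lambda>u. (vector [u, v1 u 0, 0, 0] :: complex^4) $ i) \<longlongrightarrow> 0 $ i) (nhds 0)" for i
        using exhaust_4[of i] lim[OF d1] v10[of 0] r by (auto simp: filterlim_ident)
    qed
    show "\<forall>\<^sub>F u in nhds 0. vector [u, v1 u 0, 0, 0] \<in> holonomy_graph v1 v2 r"
      using small by eventually_elim (use r v20 in \<open>auto simp: holonomy_graph_def nth\<close>)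
  qed
  have "\<forall>\<^sub>F u in nhds 0. of_rat (A$2$1) * u + of_rat (A$2$2) * v1 u 0 =
      v1 (of_rat (A$1$1) * u + of_rat (A$1$2) * v1 u 0) 0"
    using e1
  proof eventually_elim
    case (elim u)
    moreover have "?L *v vector [u, v1 u 0, 0, 0] =
        vector [of_rat (A$1$1) * u + of_rat (A$1$2) * v1 u 0,
          of_rat (A$2$1) * u + of_rat (A$2$2) * v1 u 0, 0, 0]"
      by (simp add: vec_eq_iff forall_4 matrix_vector_mult_def sum_4)
    \<comment> \<open>The image lies in the graph and has third coordinate 0, so its parameters are
      its first coordinate and 0; its second coordinate is then a value of
      \<open>v1\<close>.\<close>
    ultimately show ?case by (auto simp: holonomy_graph_def nth)
  qed
  then show "of_rat (A$2$1) + of_rat (A$2$2) * \<tau>1 = \<tau>1 * (of_rat (A$1$1) + of_rat (A$1$2) * \<tau>1)"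
    using d1 v10[of 0] r by (intro tangent_slope_invariant) auto
  have e2: "\<forall>\<^sub>F u in nhds 0. ?L *v vector [0, 0, u, v2 0 u] \<in> holonomy_graph v1 v2 r"
  proof (rule germ_preserved_along[OF G L])
    show "((\<lambda>u. vector [0, 0, u, v2 0 u] :: complex^4) \<longlongrightarrow> 0) (nhds 0)"
    proof (rule vec_tendstoI)
      show "((\<lambda>u. (vector [0, 0, u, v2 0 u] :: complex^4) $ i) \<longlongrightarrow> 0 $ i) (nhds 0)" for i
        using exhaust_4[of i] lim[OF d2] v20[of 0] r by (auto simp: filterlim_ident)
    qed
    show "\<forall>\<^sub>F u in nhds 0. vector [0, 0, u, v2 0 u] \<in> holonomy_graph v1 v2 r"
      using small by eventually_elim (use r v10 in \<open>auto simp: holonomy_graph_def nth\<close>)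
  qed
  have "\<forall>\<^sub>F u in nhds 0. of_rat (B$2$1) * u + of_rat (B$2$2) * v2 0 u =
      v2 0 (of_rat (B$1$1) * u + of_rat (B$1$2) * v2 0 u)"
    using e2
  proof eventually_elim
    case (elim u)
    moreover have "?L *v vector [0, 0, u, v2 0 u] =
        vector [0, 0, of_rat (B$1$1) * u + of_rat (B$1$2) * v2 0 u,
          of_rat (B$2$1) * u + of_rat (B$2$2) * v2 0 u]"
      by (simp add: vec_eq_iff forall_4 matrix_vector_mult_def sum_4)
    ultimately show ?case by (auto simp: holonomy_graph_def nth)
  qed
  then show "of_rat (B$2$1) + of_rat (B$2$2) * \<tau>2 = \<tau>2 * (of_rat (B$1$1) + of_rat (B$1$2) * \<tau>2)"
    using d2 v20[of 0] r by (intro tangent_slope_invariant) auto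
qed

subsection \<open>Fields of cusp shapes\<close>

text \<open>In a non-real \<tau> the square root of \<open>d\<close> has a nonzero coefficient, so
  this root is a rational affine expression in \<tau> and hence in the square root of
  \<open>e\<close>. This transfers both cusp shapes from their common field once one of them is
  located.\<close>

lemma Qsqrt_cong_nonreal:
  assumes "\<tau> \<in> Qsqrt d" "\<tau> \<in> Qsqrt e" "\<tau> \<notin> \<real>"
  shows "Qsqrt d \<subseteq> Qsqrt e"
proof
  let ?d = "csqrt (of_int d)" and ?e = "csqrt (of_int e)"
  obtain a b where t1: "\<tau> = of_rat a + of_rat b * ?d"
    using assms(1) unfolding Qsqrt_def by blast
  obtain p q where t2: "\<tau> = of_rat p + of_rat q * ?e"
    using assms(2) unfolding Qsqrt_def by blast
  have "of_rat a \<in> (\<real> :: complex set)"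
    by (cases a) (simp add: of_rat_rat)
  then have b: "b \<noteq> 0" using t1 assms(3) by auto
  have "of_rat b * ?d = of_rat (p - a) + of_rat q * ?e"
    using t1 t2 by (simp add: of_rat_diff algebra_simps)
  then have d: "?d = of_rat ((p - a) / b) + of_rat (q / b) * ?e"
    using b by (simp add: of_rat_divide field_simps)
  fix z assume "z \<in> Qsqrt d"
  then obtain x y where "z = of_rat x + of_rat y * ?d" by (auto simp: Qsqrt_def)
  then have "z = of_rat (x + y * ((p - a) / b)) + of_rat (y * (q / b)) * ?e"
    unfolding of_rat_add of_rat_mult by (simp add: d distrib_left mult.assoc)
  then show "z \<in> Qsqrt e" unfolding Qsqrt_def by blast
qed

text \<open>The tangent condition is b \<tau>^2 + (a - d) \<tau> - c = 0, with discriminant t^2 - 4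
  for the integral trace t. As \<tau> is not real, this is negative, which leaves the values -4 and
  -3.\<close>

lemma cusp_shape_field:
  fixes A :: "rat^2^2"
  assumes det: "det A = 1" and ns: "A \<noteq> mat 1" "A \<noteq> - mat 1" and tr: "trace A \<in> \<int>"
    and \<tau>: "\<tau> \<notin> \<real>"
    and tan: "of_rat (A$2$1) + of_rat (A$2$2) * \<tau> = \<tau> * (of_rat (A$1$1) + of_rat (A$1$2) * \<tau>)"
  shows "\<tau> \<in> Qsqrt (-3) \<or> \<tau> \<in> Qsqrt (-1)"
proof -
  define a b c d where "a = A$1$1" "b = A$1$2" "c = A$2$1" "d = A$2$2"
  note abcd = a_b_c_d_def
  have tan': "of_rat c + of_rat d * \<tau> = \<tau> * (of_rat a + of_rat b * \<tau>)"
    using tan by (simp only: abcd)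
  obtain t :: int where t: "a + d = of_int t"
    using tr by (auto simp: abcd trace_def sum_2 elim: Ints_cases)
  have dt: "a * d - b * c = 1" using det by (simp add: abcd det_2)
  have real: "of_rat x \<in> (\<real> :: complex set)" for x
    by (cases x) (simp add: of_rat_rat)
  \<comment> \<open>For b = 0 the tangent condition is linear over the rationals: either \<tau>
    would be rational, or a = d and c = 0, making \<open>A\<close> scalar.\<close>
  have b: "b \<noteq> 0"
  proof
    assume b: "b = 0"
    have e: "of_rat c = of_rat (a - d) * \<tau>"
      using tan' by (simp add: b of_rat_diff algebra_simps)
    have "a = d"
    proof (rule ccontr)
      assume "a \<noteq> d"
      then have "\<tau> = of_rat (c / (a - d))" using e by (simp add: of_rat_divide field_simps)
      with \<tau> real show False by metis
    qed
    with e have "c = 0" by simp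
    with b \<open>a = d\<close> scalar_det_1[OF det] ns show False by (simp add: abcd)
  qed
  \<comment> \<open>Completing the square: \<open>w\<close> is a square root of the
    discriminant.\<close>
  define w where "w = of_rat (a - d) + 2 * of_rat b * \<tau>"
  have w\<tau>: "\<tau> = of_rat ((d - a) / (2 * b)) + of_rat (1 / (2 * b)) * w"
    using b by (simp add: w_def of_rat_divide of_rat_diff of_rat_mult field_simps)
  have "w^2 = of_rat ((a - d)^2) + 4 * of_rat b * (\<tau> * (of_rat a + of_rat b * \<tau>) - of_rat d * \<tau>)"
    by (simp add: w_def power2_eq_square of_rat_mult of_rat_diff of_rat_add algebra_simps)
  also have "\<dots> = of_rat ((a - d)^2 + 4 * b * c)"
    unfolding tan'[symmetric] by (simp add: of_rat_add of_rat_mult mult.assoc)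
  also have "(a - d)^2 + 4 * b * c = (a + d)^2 - 4 * (a * d - b * c)"
    by (simp add: power2_eq_square algebra_simps)
  also have "\<dots> = of_int (t^2 - 4)"
    by (simp add: t dt)
  finally have w2: "w^2 = of_int (t^2 - 4)" by (simp only: of_rat_of_int_eq)
  have "w \<notin> \<real>"
    using \<tau> real w\<tau> by (metis Reals_add Reals_mult)
  moreover have "w \<in> \<real>" if "t^2 - 4 \<ge> 0"
  proof -
    have "0 \<le> real_of_int (t^2 - 4)"
      using that by (simp only: of_int_0_le_iff)
    then have "w^2 = (of_real (sqrt (of_int (t^2 - 4))))^2"
      by (simp only: w2 real_sqrt_pow2 of_real_of_int_eq flip: of_real_power)
    then show ?thesis by (auto simp: power2_eq_iff)
  qed
  ultimately have "\<not> t^2 - 4 \<ge> 0" by blast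
  then have "\<bar>t\<bar>^2 < 2^2" by simp
  then have "\<bar>t\<bar> < 2" by (rule power2_less_imp_less) simp
  then have "t = 0 \<or> t = 1 \<or> t = -1" by linarith
  then have "t = 0 \<or> t^2 = 1" by auto
  then show ?thesis
  proof
    assume "t = 0"
    then have "(w / 2)^2 = (csqrt (of_int (-1)))^2"
      using w2 by (simp add: power_divide)
    then have "w / 2 = csqrt (of_int (-1)) \<or> w / 2 = - csqrt (of_int (-1))"
      by (simp only: power2_eq_iff)
    \<comment> \<open>Only the square of \<open>w\<close> is known; the undetermined sign goes into
      the rational coefficient.\<close>
    then have "\<tau> = of_rat ((d - a) / (2 * b)) + of_rat (1 / b) * csqrt (of_int (-1)) \<or>
        \<tau> = of_rat ((d - a) / (2 * b)) + of_rat (- 1 / b) * csqrt (of_int (-1))"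
      using b by (subst (1 2) w\<tau>) (auto simp: of_rat_divide of_rat_mult of_rat_minus field_simps)
    then show ?thesis unfolding Qsqrt_def by blast
  next
    assume "t^2 = 1"
    then have "w^2 = (csqrt (of_int (-3)))^2"
      unfolding power2_csqrt w2 by simp
    then have "w = csqrt (of_int (-3)) \<or> w = - csqrt (of_int (-3))"
      by (simp only: power2_eq_iff)
    then have "\<tau> = of_rat ((d - a) / (2 * b)) + of_rat (1 / (2 * b)) * csqrt (of_int (-3)) \<or>
        \<tau> = of_rat ((d - a) / (2 * b)) + of_rat (- 1 / (2 * b)) * csqrt (of_int (-3))"
      by (subst (1 2) w\<tau>) (auto simp: of_rat_minus)
    then show ?thesis unfolding Qsqrt_def by blast
  qed
qed

text \<open>At least one block differs from plus and minus the identity. It locates its own cusp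
  shape, and the common field of the shapes carries the other one along.\<close>

lemma cusp_shapes_fields:
  assumes X: "ghol X \<tau>1 \<tau>2" and \<tau>: "\<tau>1 \<in> Qsqrt d" "\<tau>2 \<in> Qsqrt d"
    and M: "M \<in> AutQ X" "type_I M" "M \<noteq> iota" "M \<noteq> - iota" "M \<noteq> mat 1" "M \<noteq> - mat 1"
  shows "{\<tau>1, \<tau>2} \<subseteq> Qsqrt (-3) \<or> {\<tau>1, \<tau>2} \<subseteq> Qsqrt (-1)"
proof -
  obtain A B where AB: "M = A \<oplus>\<^sub>m B" "det A = 1" "det B = 1"
    using M(2) by (auto simp: type_I_iff)
  have fin: "finite (AutQ X)"
    using X subgroup_AutQ unfolding ghol_def by blast
  have nr: "\<tau>1 \<notin> \<real>" "\<tau>2 \<notin> \<real>"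
    using X unfolding ghol_def by blast+
  note Aut = M(1)[unfolded AB(1)]
  note tr = block_trace_Ints[OF fin Aut AB(2,3)]
  note tan = ghol_block_tangent[OF X Aut]
  have in_fields: "{\<tau>1, \<tau>2} \<subseteq> Qsqrt e" if "\<tau>1 \<in> Qsqrt e \<or> \<tau>2 \<in> Qsqrt e" for e
  proof -
    have "Qsqrt d \<subseteq> Qsqrt e"
      using that Qsqrt_cong_nonreal[OF \<tau>(1) _ nr(1)] Qsqrt_cong_nonreal[OF \<tau>(2) _ nr(2)]
      by (elim disjE)
    with \<tau> show ?thesis by (simp add: subset_iff)
  qed
  \<comment> \<open>The four sign combinations of identity blocks are exactly the four excluded
    matrices.\<close>
  have "\<not> (A = mat 1 \<or> A = - mat 1) \<or> \<not> (B = mat 1 \<or> B = - mat 1)"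
    using M(3-6) direct_sum_signs unfolding AB(1) by metis
  then show ?thesis
  proof
    assume "\<not> (A = mat 1 \<or> A = - mat 1)"
    then have "\<tau>1 \<in> Qsqrt (-3) \<or> \<tau>1 \<in> Qsqrt (-1)"
      by (intro cusp_shape_field[OF AB(2) _ _ tr(1) nr(1) tan(1)]) blast+
    then show ?thesis using in_fields by blast
  next
    assume "\<not> (B = mat 1 \<or> B = - mat 1)"
    then have "\<tau>2 \<in> Qsqrt (-3) \<or> \<tau>2 \<in> Qsqrt (-1)"
      by (intro cusp_shape_field[OF AB(3) _ _ tr(2) nr(2) tan(2)]) blast+
    then show ?thesis using in_fields by blast
  qed
qed

subsection \<open>Minimal polynomials of automorphisms of Type I\<close>

lemma mat_minus: "mat (- c) = (- mat c :: 'a::group_add^'n^'n)"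
  by (simp add: vec_eq_iff mat_def)

text \<open>Among matrices of determinant one, the two excluded ones are the only scalar ones. In
  the uses below, \<open>p\<close> is the minimal polynomial of the whole block sum.\<close>

definition nonscalar_block :: "rat poly \<Rightarrow> rat^2^2 \<Rightarrow> bool" where
  "nonscalar_block p A \<longleftrightarrow>
     det A = 1 \<and> A \<noteq> mat 1 \<and> A \<noteq> - mat 1 \<and> matrix_poly p A = 0"

lemma nonscalar_blockD:
  assumes "nonscalar_block p A"
  shows "invertible A" "invertible (- A)" "is_minpoly A [:1, - trace A, 1:]"
    "is_minpoly (- A) [:1, trace A, 1:]" "[:1, - trace A, 1:] dvd p"
proof -
  have "det (- A) = 1" "trace (- A) = - trace A" "- A \<noteq> mat 1" "- A \<noteq> - mat 1"
    using assms by (auto simp: nonscalar_block_def det_2 trace_def sum_2 minus_equation_iff[of A])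
  then show "invertible A" "invertible (- A)" "is_minpoly A [:1, - trace A, 1:]"
    "is_minpoly (- A) [:1, trace A, 1:]"
    using assms is_minpoly_det_1[of A] is_minpoly_det_1[of "- A"]
    by (auto simp: nonscalar_block_def invertible_det_nz)
  then show "[:1, - trace A, 1:] dvd p"
    using assms is_minpoly_dvd by (auto simp: nonscalar_block_def)
qed

text \<open>The polynomial \<open>p\<close> annihilates both blocks. A block equal to
  \<open>mat e\<close> makes \<open>e\<close> a root of \<open>p\<close>, and the hypotheses on
  \<open>M\<close> rule out that both blocks have this form.\<close>

lemma type_I_minpoly_cases:
  assumes M: "type_I M" "is_minpoly M p"
    and ns: "M \<noteq> mat 1" "M \<noteq> - mat 1" "M \<noteq> iota" "M \<noteq> - iota"
  obtains (both) A B where "M = A \<oplus>\<^sub>m B" "nonscalar_block p A" "nonscalar_block p B"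
      "trace A = trace B \<Longrightarrow> degree p \<le> 2"
    | (left) A e where "M = A \<oplus>\<^sub>m mat e" "nonscalar_block p A" "e = 1 \<or> e = -1" "poly p e = 0"
    | (right) B e where "M = mat e \<oplus>\<^sub>m B" "nonscalar_block p B" "e = 1 \<or> e = -1" "poly p e = 0"
proof -
  obtain A B where AB: "M = A \<oplus>\<^sub>m B" "det A = 1" "det B = 1"
    using M(1) by (auto simp: type_I_iff)
  have "matrix_poly p A \<oplus>\<^sub>m matrix_poly p B = 0 \<oplus>\<^sub>m 0"
    using M(2) by (simp add: is_minpoly_def AB(1) matrix_poly_direct_sum direct_sum_zero)
  then have p: "matrix_poly p A = 0" "matrix_poly p B = 0"
    by (simp_all add: direct_sum_eq_iff)
  have scalar: "\<exists>e. C = mat e \<and> (e = 1 \<or> e = -1) \<and> poly p e = 0"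
    if "det C = 1" "matrix_poly p C = 0" "\<not> nonscalar_block p C" for C
  proof -
    have "C = mat 1 \<or> C = mat (- 1)"
      using that by (auto simp: nonscalar_block_def mat_minus)
    then obtain e where e: "C = mat e" "e = 1 \<or> e = -1" by blast
    with that have "mat (poly p e) = (0 :: rat^2^2)" by (simp add: matrix_poly_mat)
    then have "poly p e = 0" by (simp add: vec_eq_iff mat_def forall_2)
    with e show ?thesis by blast
  qed
  show thesis
  proof (cases "nonscalar_block p A"; cases "nonscalar_block p B")
    assume ns_blocks: "nonscalar_block p A" "nonscalar_block p B"
    have "degree p \<le> 2" if "trace A = trace B"
    proof -
      \<comment> \<open>With equal traces a single quadratic annihilates both blocks, hence
        \<open>M\<close>, and minimality of \<open>p\<close> bounds its degree.\<close>
      have "matrix_poly [:1, - trace A, 1:] M = 0"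
        using nonscalar_blockD(3)[OF ns_blocks(1)] nonscalar_blockD(3)[OF ns_blocks(2)] that
        by (simp add: is_minpoly_def AB(1) matrix_poly_direct_sum direct_sum_zero)
      moreover have "[:1, - trace A, 1:] \<noteq> 0" by simp
      ultimately have "degree p \<le> degree [:1, - trace A, 1:]"
        using M(2) unfolding is_minpoly_def by blast
      then show ?thesis by simp
    qed
    then show thesis by (rule both[OF AB(1) ns_blocks])
  next
    assume "nonscalar_block p A" "\<not> nonscalar_block p B"
    then show thesis using scalar[of B] AB p left by blast
  next
    assume "\<not> nonscalar_block p A" "nonscalar_block p B"
    then show thesis using scalar[of A] AB p right by blast
  next
    assume "\<not> nonscalar_block p A" "\<not> nonscalar_block p B"
    then obtain e e' where "A = mat e" "B = mat e'" "e = 1 \<or> e = -1" "e' = 1 \<or> e' = -1"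
      using scalar AB p by blast
    then show thesis
      using ns AB(1) by (auto simp: mat_minus direct_sum_signs)
  qed
qed

text \<open>A nonscalar block has trace \<open>t\<close> by the linear coefficient of the remainder.
  A scalar block would make 1 or -1 a root, which means that \<open>t\<close> is 2 or -2.\<close>

lemma type_I_minpoly_quadratic:
  assumes "type_I M" "is_minpoly M [:1, -t, 1:]"
    and "M \<noteq> mat 1" "M \<noteq> - mat 1" "M \<noteq> iota" "M \<noteq> - iota" and "t \<noteq> 2" "t \<noteq> -2"
  shows "\<exists>A B. invertible A \<and> invertible B \<and>
    is_minpoly A [:1, -t, 1:] \<and> is_minpoly B [:1, -t, 1:] \<and> M = A \<oplus>\<^sub>m B"
proof -
  have tr: "trace A = t" if "nonscalar_block [:1, -t, 1:] A" for A
    using monic_quadratic_dvd_quartic(2)[of "trace A" 1 "-t" 1 0 0] nonscalar_blockD(5)[OF that]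
    by simp
  from assms(1-6) show ?thesis
  proof (cases rule: type_I_minpoly_cases)
    case (both A B)
    have "trace A = t" "trace B = t" using both tr by blast+
    then show ?thesis
      using both(1) nonscalar_blockD[OF both(2)] nonscalar_blockD[OF both(3)]
      by (intro exI[of _ A] exI[of _ B]) simp
  qed (use assms(7,8) in auto)
qed

text \<open>The cubic is (x - e)(x^2 - t x + 1), the common shape of all cubics in the theorem. A
  nonscalar block has trace \<open>t\<close>; two such blocks would force degree at most 2, so
  exactly one block is scalar.\<close>

lemma type_I_minpoly_cubic:
  assumes "type_I M" "is_minpoly M [:- e, 1 + e * t, - (t + e), 1:]"
    and "M \<noteq> mat 1" "M \<noteq> - mat 1" "M \<noteq> iota" "M \<noteq> - iota"
    and e: "e = 1 \<or> e = -1" and t: "t \<noteq> 2" "t \<noteq> -2"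
  shows "(\<exists>A. invertible A \<and> is_minpoly A [:1, -t, 1:] \<and> M = A \<oplus>\<^sub>m mat e) \<or>
    (\<exists>B. invertible B \<and> is_minpoly B [:1, -t, 1:] \<and> M = mat e \<oplus>\<^sub>m B)"
proof -
  let ?p = "[:- e, 1 + e * t, - (t + e), 1:]"
  have tr: "trace A = t" if "nonscalar_block ?p A" for A
    using monic_quadratic_dvd_quartic(1)[of "trace A" "- e" "1 + e * t" "- (t + e)" 1 0]
      nonscalar_blockD(5)[OF that]
    by simp
  \<comment> \<open>At \<open>- e\<close> the cubic takes the value -2 e (2 + e t), which is nonzero
    since \<open>t\<close> is neither 2 nor -2.\<close>
  have root: "e' = e" if "poly ?p e' = 0" "e' = 1 \<or> e' = -1" for e'
    using that e t by auto
  from assms(1-6) show ?thesis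
  proof (cases rule: type_I_minpoly_cases)
    case (both A B)
    then show ?thesis using tr by simp
  next
    case (left A e')
    then have "trace A = t" "e' = e" using tr root by blast+
    then show ?thesis
      using left(1) nonscalar_blockD[OF left(2)] by (intro disjI1 exI[of _ A]) simp
  next
    case (right B e')
    then have "trace B = t" "e' = e" using tr root by blast+
    then show ?thesis
      using right(1) nonscalar_blockD[OF right(2)] by (intro disjI2 exI[of _ B]) simp
  qed
qed

text \<open>The quartic is (x^2 + x + 1)(x^2 - x + 1) and has value 3 at 1 and -1, so both blocks
  are nonscalar with traces 1 or -1. Equal traces would force degree at most 2; hence the traces are
  opposite, and negating the block of trace 1 gives x^2 + x + 1 for both.\<close>

lemma type_I_minpoly_quartic:
  assumes "type_I M" "is_minpoly M [:1, 0, 1, 0, 1:]"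
    and "M \<noteq> mat 1" "M \<noteq> - mat 1" "M \<noteq> iota" "M \<noteq> - iota"
  shows "(\<exists>A B. invertible A \<and> invertible B \<and>
      is_minpoly A [:1, 1, 1:] \<and> is_minpoly B [:1, 1, 1:] \<and> M = A \<oplus>\<^sub>m (- B)) \<or>
    (\<exists>A B. invertible A \<and> invertible B \<and>
      is_minpoly A [:1, 1, 1:] \<and> is_minpoly B [:1, 1, 1:] \<and> M = (- A) \<oplus>\<^sub>m B)"
proof -
  have tr: "trace A = 1 \<or> trace A = -1" if "nonscalar_block [:1, 0, 1, 0, 1:] A" for A
    using monic_quadratic_dvd_quartic(1)[of "trace A" 1 0 1 0 1] nonscalar_blockD(5)[OF that]
    by (simp add: power2_eq_1_iff)
  from assms show ?thesis
  proof (cases rule: type_I_minpoly_cases)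
    case (both A B)
    have ne: "trace A \<noteq> trace B" using both(4) by auto
    consider "trace A = -1" "trace B = 1" | "trace A = 1" "trace B = -1"
      using tr[OF both(2)] tr[OF both(3)] ne by metis
    then show ?thesis
    proof cases
      case 1
      then show ?thesis
        using both(1) nonscalar_blockD[OF both(2)] nonscalar_blockD[OF both(3)]
        \<comment> \<open>The witness \<open>- B\<close> has trace -1, and negating it again
          recovers the block \<open>B\<close>.\<close>
        by (intro disjI1 exI[of _ A] exI[of _ "- B"]) simp
    next
      case 2
      then show ?thesis
        using both(1) nonscalar_blockD[OF both(2)] nonscalar_blockD[OF both(3)]
        by (intro disjI2 exI[of _ "- A"] exI[of _ B]) simp
    qed
  qed auto
qed

theorem theorem9p1:
  fixes X :: "(complex^4) set" and \<tau>1 \<tau>2 :: complex and K :: "complex set"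
    and M :: "rat^4^4"
  assumes "ghol X \<tau>1 \<tau>2"
    and "quadratic_field K" and "\<tau>1 \<in> K" and "\<tau>2 \<in> K"
    and "M \<in> AutQ X" and "type_I M"
    and "M \<noteq> iota" and "M \<noteq> - iota" and "M \<noteq> mat 1" and "M \<noteq> - mat 1"
  shows "({\<tau>1, \<tau>2} \<subseteq> Qsqrt (-3) \<or> {\<tau>1, \<tau>2} \<subseteq> Qsqrt (-1)) \<and>
         ({\<tau>1, \<tau>2} \<subseteq> Qsqrt (-3) \<longrightarrow>
           (is_minpoly M [:1, 1, 1:] \<longrightarrow>
             (\<exists>A1 A4. invertible A1 \<and> invertible A4 \<and>
               is_minpoly A1 [:1, 1, 1:] \<and> is_minpoly A4 [:1, 1, 1:] \<and> M = A1 \<oplus>\<^sub>m A4) \<or>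
             (\<exists>A1. invertible A1 \<and> is_minpoly A1 [:1, 1, 1:] \<and> M = A1 \<oplus>\<^sub>m (- mat 1)) \<or>
             (\<exists>A4. invertible A4 \<and> is_minpoly A4 [:1, 1, 1:] \<and> M = (- mat 1) \<oplus>\<^sub>m A4)) \<and>
           (is_minpoly M [:1, -1, 1:] \<longrightarrow>
             (\<exists>A1 A4. invertible A1 \<and> invertible A4 \<and>
               is_minpoly A1 [:1, -1, 1:] \<and> is_minpoly A4 [:1, -1, 1:] \<and> M = A1 \<oplus>\<^sub>m A4) \<or>
             (\<exists>A1. invertible A1 \<and> is_minpoly A1 [:1, -1, 1:] \<and> M = A1 \<oplus>\<^sub>m mat 1) \<or>
             (\<exists>A4. invertible A4 \<and> is_minpoly A4 [:1, -1, 1:] \<and> M = mat 1 \<oplus>\<^sub>m A4)) \<and>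
           (is_minpoly M [:-1, 0, 0, 1:] \<longrightarrow>
             (\<exists>A1. invertible A1 \<and> is_minpoly A1 [:1, 1, 1:] \<and> M = A1 \<oplus>\<^sub>m mat 1) \<or>
             (\<exists>A4. invertible A4 \<and> is_minpoly A4 [:1, 1, 1:] \<and> M = mat 1 \<oplus>\<^sub>m A4)) \<and>
           (is_minpoly M [:1, 0, 0, 1:] \<longrightarrow>
             (\<exists>A1. invertible A1 \<and> is_minpoly A1 [:1, -1, 1:] \<and> M = A1 \<oplus>\<^sub>m (- mat 1)) \<or>
             (\<exists>A4. invertible A4 \<and> is_minpoly A4 [:1, -1, 1:] \<and> M = (- mat 1) \<oplus>\<^sub>m A4)) \<and>
           (is_minpoly M [:-1, 2, -2, 1:] \<longrightarrow>
             (\<exists>A1. invertible A1 \<and> is_minpoly A1 [:1, -1, 1:] \<and> M = A1 \<oplus>\<^sub>m mat 1) \<or>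
             (\<exists>A4. invertible A4 \<and> is_minpoly A4 [:1, -1, 1:] \<and> M = mat 1 \<oplus>\<^sub>m A4)) \<and>
           (is_minpoly M [:1, 2, 2, 1:] \<longrightarrow>
             (\<exists>A1. invertible A1 \<and> is_minpoly A1 [:1, 1, 1:] \<and> M = A1 \<oplus>\<^sub>m (- mat 1)) \<or>
             (\<exists>A4. invertible A4 \<and> is_minpoly A4 [:1, 1, 1:] \<and> M = (- mat 1) \<oplus>\<^sub>m A4)) \<and>
           (is_minpoly M [:1, 0, 1, 0, 1:] \<longrightarrow>
             (\<exists>A1 A4. invertible A1 \<and> invertible A4 \<and>
               is_minpoly A1 [:1, 1, 1:] \<and> is_minpoly A4 [:1, 1, 1:] \<and> M = A1 \<oplus>\<^sub>m (- A4)) \<or>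
             (\<exists>A1 A4. invertible A1 \<and> invertible A4 \<and>
               is_minpoly A1 [:1, 1, 1:] \<and> is_minpoly A4 [:1, 1, 1:] \<and> M = (- A1) \<oplus>\<^sub>m A4))) \<and>
         ({\<tau>1, \<tau>2} \<subseteq> Qsqrt (-1) \<longrightarrow>
           (is_minpoly M [:1, 0, 1:] \<longrightarrow>
             (\<exists>A1 A4. invertible A1 \<and> invertible A4 \<and>
               is_minpoly A1 [:1, 0, 1:] \<and> is_minpoly A4 [:1, 0, 1:] \<and> M = A1 \<oplus>\<^sub>m A4)) \<and>
           (is_minpoly M [:-1, 1, -1, 1:] \<longrightarrow>
             (\<exists>A1. invertible A1 \<and> is_minpoly A1 [:1, 0, 1:] \<and> M = A1 \<oplus>\<^sub>m mat 1) \<or>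
             (\<exists>A4. invertible A4 \<and> is_minpoly A4 [:1, 0, 1:] \<and> M = mat 1 \<oplus>\<^sub>m A4)) \<and>
           (is_minpoly M [:1, 1, 1, 1:] \<longrightarrow>
             (\<exists>A1. invertible A1 \<and> is_minpoly A1 [:1, 0, 1:] \<and> M = A1 \<oplus>\<^sub>m (- mat 1)) \<or>
             (\<exists>A4. invertible A4 \<and> is_minpoly A4 [:1, 0, 1:] \<and> M = (- mat 1) \<oplus>\<^sub>m A4)))"
proof -
  note quad = type_I_minpoly_quadratic[OF assms(6) _ assms(9,10,7,8)]
  note cub = type_I_minpoly_cubic[OF assms(6) _ assms(9,10,7,8)]
  \<comment> \<open>The instantiated parameter is the trace of each block: -1, 1 and 0 for
    eigenvalues of order 3, 6 and 4.\<close>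
  have q3: "\<exists>A1 A4. invertible A1 \<and> invertible A4 \<and>
      is_minpoly A1 [:1, 1, 1:] \<and> is_minpoly A4 [:1, 1, 1:] \<and> M = A1 \<oplus>\<^sub>m A4"
    if "is_minpoly M [:1, 1, 1:]"
    using quad[of "-1"] that by simp
  have q6: "\<exists>A1 A4. invertible A1 \<and> invertible A4 \<and>
      is_minpoly A1 [:1, -1, 1:] \<and> is_minpoly A4 [:1, -1, 1:] \<and> M = A1 \<oplus>\<^sub>m A4"
    if "is_minpoly M [:1, -1, 1:]"
    using quad[of "1"] that by simp
  have q4: "\<exists>A1 A4. invertible A1 \<and> invertible A4 \<and>
      is_minpoly A1 [:1, 0, 1:] \<and> is_minpoly A4 [:1, 0, 1:] \<and> M = A1 \<oplus>\<^sub>m A4"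
    if "is_minpoly M [:1, 0, 1:]"
    using quad[of "0"] that by simp
  \<comment> \<open>Each cubic is split as (x - e)(x^2 - t x + 1), and the two instantiations are
    \<open>e\<close> and \<open>t\<close>; here x^3 - 1 = (x - 1)(x^2 + x + 1).\<close>
  have c1: "(\<exists>A1. invertible A1 \<and> is_minpoly A1 [:1, 1, 1:] \<and> M = A1 \<oplus>\<^sub>m mat 1) \<or>
      (\<exists>A4. invertible A4 \<and> is_minpoly A4 [:1, 1, 1:] \<and> M = mat 1 \<oplus>\<^sub>m A4)"
    if "is_minpoly M [:-1, 0, 0, 1:]"
    using cub[of "1" "-1"] that by (simp add: mat_minus)
  have c2: "(\<exists>A1. invertible A1 \<and> is_minpoly A1 [:1, -1, 1:] \<and> M = A1 \<oplus>\<^sub>m (- mat 1)) \<or>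
      (\<exists>A4. invertible A4 \<and> is_minpoly A4 [:1, -1, 1:] \<and> M = (- mat 1) \<oplus>\<^sub>m A4)"
    if "is_minpoly M [:1, 0, 0, 1:]"
    using cub[of "-1" "1"] that by (simp add: mat_minus)
  have c3: "(\<exists>A1. invertible A1 \<and> is_minpoly A1 [:1, -1, 1:] \<and> M = A1 \<oplus>\<^sub>m mat 1) \<or>
      (\<exists>A4. invertible A4 \<and> is_minpoly A4 [:1, -1, 1:] \<and> M = mat 1 \<oplus>\<^sub>m A4)"
    if "is_minpoly M [:-1, 2, -2, 1:]"
    using cub[of "1" "1"] that by (simp add: mat_minus)
  have c4: "(\<exists>A1. invertible A1 \<and> is_minpoly A1 [:1, 1, 1:] \<and> M = A1 \<oplus>\<^sub>m (- mat 1)) \<or>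
      (\<exists>A4. invertible A4 \<and> is_minpoly A4 [:1, 1, 1:] \<and> M = (- mat 1) \<oplus>\<^sub>m A4)"
    if "is_minpoly M [:1, 2, 2, 1:]"
    using cub[of "-1" "-1"] that by (simp add: mat_minus)
  have c5: "(\<exists>A1. invertible A1 \<and> is_minpoly A1 [:1, 0, 1:] \<and> M = A1 \<oplus>\<^sub>m mat 1) \<or>
      (\<exists>A4. invertible A4 \<and> is_minpoly A4 [:1, 0, 1:] \<and> M = mat 1 \<oplus>\<^sub>m A4)"
    if "is_minpoly M [:-1, 1, -1, 1:]"
    using cub[of "1" "0"] that by (simp add: mat_minus)
  have c6: "(\<exists>A1. invertible A1 \<and> is_minpoly A1 [:1, 0, 1:] \<and> M = A1 \<oplus>\<^sub>m (- mat 1)) \<or>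
      (\<exists>A4. invertible A4 \<and> is_minpoly A4 [:1, 0, 1:] \<and> M = (- mat 1) \<oplus>\<^sub>m A4)"
    if "is_minpoly M [:1, 1, 1, 1:]"
    using cub[of "-1" "0"] that by (simp add: mat_minus)
  have fields: "{\<tau>1, \<tau>2} \<subseteq> Qsqrt (-3) \<or> {\<tau>1, \<tau>2} \<subseteq> Qsqrt (-1)"
    using assms cusp_shapes_fields unfolding quadratic_field_def by blast
  show ?thesis
    by (intro conjI impI fields)
      (erule disjI1[OF q3] disjI1[OF q6] q4 c1 c2 c3 c4 c5 c6
        type_I_minpoly_quartic[OF assms(6) _ assms(9,10,7,8)])+
qed

end
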